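(* Let $\alpha \in (0,1)$. For every $w > 0$ the following is true. The $1-\alpha$ confidence set $C(x) = \{\theta \in \mathbb{R} : x \in A(\theta)\}$ is an interval for all sufficiently large $|x|$, with endpoints approaching those of the standard $1-\alpha$ confidence interval $[x - z_{\alpha/2}, x + z_{\alpha/2}]$ as $|x| \to \infty$ (that is, the differences between the lower endpoint of $C(x)$ and $x - z_{\alpha/2}$, and between the upper endpoint of $C(x)$ and $x + z_{\alpha/2}$, tend to $0$ as $|x| \to \infty$).
   Context: Let $\phi(x) = (2\pi)^{-1/2} e^{-x^2/2}$ denote the $N(0,1)$ density, and for $a \in (0,1)$ let $z_a$ be defined by $P(Z > z_a) = a$ for $Z \sim N(0,1)$. For $\theta \in \mathbb{R}$, $P_\theta$ denotes probability when $X \sim N(\theta,1)$. For $w > 0$, $c > 0$ and $\theta \in \mathbb{R}$ define $g(x,c,\theta) = \frac{w + \phi(x)}{\phi(x-\theta)} - c$ and $B(c,\theta) = \{x \in \mathbb{R} : g(x,c,\theta) < 0\}$. Let $c_\alpha(\theta)$ be the value of $c$ such that $P_\theta(X \in B(c,\theta)) = 1-\alpha$. The $1-\alpha$ acceptance region is $A(\theta) = B(c_\alpha(\theta),\theta)$, and the corresponding confidence set $C(x)$ is defined by: $\theta \in C(x)$ if and only if $x \in A(\theta)$. *)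

theory Defs
  imports "HOL-Probability.Probability"
begin

definition normal_law :: "real \<Rightarrow> real measure" where
  "normal_law \<theta> = density lborel (\<lambda>x. ennreal (normal_density \<theta> 1 x))"

definition z_quantile :: "real \<Rightarrow> real" where
  "z_quantile a = (THE z. measure (normal_law 0) {z<..} = a)"

definition g :: "real \<Rightarrow> real \<Rightarrow> real \<Rightarrow> real \<Rightarrow> real" where
  "g w x c \<theta> = (w + std_normal_density x) / std_normal_density (x - \<theta>) - c"

definition B :: "real \<Rightarrow> real \<Rightarrow> real \<Rightarrow> real set" where
  "B w c \<theta> = {x. g w x c \<theta> < 0}"

text \<open>
  For \<open>w > 0\<close> and \<open>0 < \<alpha> < 1\<close> the level exists and is unique: \<open>\<lambda>x. g w x c \<theta>\<close> is continuous and
  strictly convex and tends to infinity at both ends, so the probability of \<open>B w c \<theta>\<close> is continuous in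
  \<open>c\<close>, is \<open>0\<close> up to the minimum of \<open>\<lambda>x. g w x 0 \<theta>\<close>, and increases strictly from there to \<open>1\<close>.
\<close>
definition c_level :: "real \<Rightarrow> real \<Rightarrow> real \<Rightarrow> real" where
  "c_level w \<alpha> \<theta> = (THE c. c > 0 \<and> measure (normal_law \<theta>) (B w c \<theta>) = 1 - \<alpha>)"

definition acceptance_region :: "real \<Rightarrow> real \<Rightarrow> real \<Rightarrow> real set" where
  "acceptance_region w \<alpha> \<theta> = B w (c_level w \<alpha> \<theta>) \<theta>"

definition confidence_set :: "real \<Rightarrow> real \<Rightarrow> real \<Rightarrow> real set" where
  "confidence_set w \<alpha> x = {\<theta>. x \<in> acceptance_region w \<alpha> \<theta>}"

end

theory Submission
  imports Defs "HOL-Real_Asymp.Real_Asymp"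
begin

text \<open>
  In the coordinate \<open>y = x - \<theta>\<close>, and up to the factor \<open>a = w * sqrt (2 * pi)\<close>, the quotient in \<open>g\<close> is
  \<open>exp (y\<^sup>2 / 2)\<close> plus a perturbation \<open>exp (- (\<theta>\<^sup>2 / 2 + \<theta> * y)) / a\<close>. It is strictly convex in \<open>y\<close>, so
  the acceptance region is an interval \<open>(\<theta> + l \<theta>, \<theta> + u \<theta>)\<close>, where \<open>(l \<theta>, u \<theta>)\<close> has standard normal
  probability \<open>1 - \<alpha>\<close>. The perturbation is at most \<open>exp (y\<^sup>2 / 2) / a\<close>, which bounds \<open>l\<close> and \<open>u\<close> uniformly
  in \<open>\<theta>\<close>; hence only \<open>\<theta>\<close> close to \<open>x\<close> can lie in \<open>C x\<close>. For \<open>y\<close> bounded and \<open>\<theta>\<close> tending to infinity the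
  perturbation vanishes together with its derivatives. Therefore \<open>l\<close> and \<open>u\<close> tend to the endpoints
  \<open>- z\<close> and \<open>z\<close> of the symmetric interval, which gives the limits of the endpoints of \<open>C x\<close>, and
  \<open>\<theta> + l \<theta>\<close> and \<open>\<theta> + u \<theta>\<close> are eventually increasing, which makes \<open>C x\<close> an interval. The case of
  negative \<open>x\<close> follows from \<open>C (- x) = - C x\<close>.
\<close>


section \<open>Normal law: translation, reflection, null sets and strict monotonicity\<close>

lemma space_normal_law [simp]: "space (normal_law \<theta>) = UNIV"
  and sets_normal_law [simp, measurable_cong]: "sets (normal_law \<theta>) = sets borel"
  by (simp_all add: normal_law_def)

lemma prob_space_normal_law: "prob_space (normal_law \<theta>)"
  unfolding normal_law_def by (rule prob_space_normal_density) simp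

interpretation normal_law: prob_space "normal_law \<theta>" for \<theta>
  by (rule prob_space_normal_law)

interpretation normal_law: real_distribution "normal_law \<theta>" for \<theta>
  by (simp add: real_distribution_def real_distribution_axioms_def prob_space_normal_law)

lemma normal_law_eq_distr: "normal_law \<theta> = distr (normal_law 0) borel ((+) \<theta>)"
proof -
  have "normal_law \<theta> = density (distr lborel borel ((+) \<theta>)) (\<lambda>x. ennreal (normal_density \<theta> 1 x))"
    by (simp add: normal_law_def lborel_distr_plus)
  also have "\<dots> = distr (density lborel (\<lambda>y. ennreal (normal_density \<theta> 1 (\<theta> + y)))) borel ((+) \<theta>)"
    by (rule density_distr) auto
  also have "(\<lambda>y. ennreal (normal_density \<theta> 1 (\<theta> + y))) = (\<lambda>y. ennreal (normal_density 0 1 y))"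
    by (simp add: normal_density_def)
  finally show ?thesis by (simp add: normal_law_def)
qed

lemma normal_law_0_uminus: "normal_law 0 = distr (normal_law 0) borel uminus"
proof -
  have "normal_law 0 = density (distr lborel borel uminus) (\<lambda>x. ennreal (normal_density 0 1 x))"
    by (simp add: normal_law_def lborel_distr_uminus)
  also have "\<dots> = distr (density lborel (\<lambda>y. ennreal (normal_density 0 1 (- y)))) borel uminus"
    by (rule density_distr) auto
  also have "(\<lambda>y. ennreal (normal_density 0 1 (- y))) = (\<lambda>y. ennreal (normal_density 0 1 y))"
    by (simp add: normal_density_def)
  finally show ?thesis by (simp add: normal_law_def)
qed

lemma measure_normal_law_shift:
  assumes "S \<in> sets borel"
  shows "measure (normal_law \<theta>) S = measure (normal_law 0) {y. \<theta> + y \<in> S}"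
  by (subst normal_law_eq_distr, subst measure_distr) (use assms in \<open>auto simp: vimage_def\<close>)

lemma measure_normal_law_uminus:
  assumes "S \<in> sets borel"
  shows "measure (normal_law 0) S = measure (normal_law 0) {y. - y \<in> S}"
  by (subst normal_law_0_uminus, subst measure_distr) (use assms in \<open>auto simp: vimage_def\<close>)

lemma normal_law_finite_null:
  assumes "finite S"
  shows "measure (normal_law \<theta>) S = 0"
proof -
  have "S \<in> null_sets lborel"
    using assms by (simp add: finite_imp_null_set_lborel)
  moreover have "absolutely_continuous lborel (normal_law \<theta>)"
    unfolding normal_law_def by (rule absolutely_continuousI_density) auto
  ultimately have "S \<in> null_sets (normal_law \<theta>)"
    by (auto simp: absolutely_continuous_def)
  then show ?thesis by (simp add: null_sets_def measure_def)
qed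

lemma normal_law_pos_interval:
  fixes a b :: real
  assumes "a < b"
  shows "0 < measure (normal_law \<theta>) {a<..<b}"
proof (rule ccontr)
  assume "\<not> ?thesis"
  then have "measure (normal_law \<theta>) {a<..<b} = 0"
    using measure_nonneg[of "normal_law \<theta>" "{a<..<b}"] by linarith
  then have "emeasure (normal_law \<theta>) {a<..<b} = 0"
    by (simp add: normal_law.emeasure_eq_measure)
  then have "(\<integral>\<^sup>+x. ennreal (normal_density \<theta> 1 x) * indicator {a<..<b} x \<partial>lborel) = 0"
    by (simp add: normal_law_def emeasure_density)
  then have "AE x in lborel. ennreal (normal_density \<theta> 1 x) * indicator {a<..<b} x = 0"
    by (subst (asm) nn_integral_0_iff_AE) auto
  then have "AE x in lborel. x \<notin> {a<..<b}"
    by eventually_elim (use normal_density_pos[of 1 \<theta>] in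
      \<open>auto simp: indicator_def ennreal_eq_0_iff not_le[symmetric] split: if_splits\<close>)
  then have "emeasure lborel {a<..<b} = 0"
    by (subst (asm) AE_iff_measurable[where N="{a<..<b}"]) auto
  with assms show False by simp
qed

lemma normal_law_pos_open:
  fixes S :: "real set"
  assumes "open S" "S \<noteq> {}"
  shows "0 < measure (normal_law \<theta>) S"
proof -
  obtain x where "x \<in> S" using assms by auto
  then obtain e where e: "e > 0" "ball x e \<subseteq> S"
    using assms by (meson open_contains_ball)
  have "0 < measure (normal_law \<theta>) {x-e<..<x+e}"
    using e by (intro normal_law_pos_interval) simp
  also have "\<dots> \<le> measure (normal_law \<theta>) S"
    using e assms by (intro normal_law.finite_measure_mono)
      (auto simp: ball_eq_greaterThanLessThan)
  finally show ?thesis .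
qed

lemma normal_law_strict_mono:
  fixes S T :: "real set"
  assumes "S \<in> sets borel" "T \<in> sets borel" "S \<subseteq> T" "open U" "U \<noteq> {}" "U \<subseteq> T - S"
  shows "measure (normal_law \<theta>) S < measure (normal_law \<theta>) T"
proof -
  have "measure (normal_law \<theta>) S + 0 < measure (normal_law \<theta>) S + measure (normal_law \<theta>) U"
    using normal_law_pos_open[of U] assms by simp
  also have "\<dots> = measure (normal_law \<theta>) (S \<union> U)"
    using assms by (subst normal_law.finite_measure_Union) auto
  also have "\<dots> \<le> measure (normal_law \<theta>) T"
    using assms by (intro normal_law.finite_measure_mono) auto
  finally show ?thesis by simp
qed

lemma normal_law_interval_less:
  fixes l u l' u' :: real
  assumes "l' \<le> l" "u \<le> u'" "l' < l \<or> u < u'" "l' < u'"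
  shows "measure (normal_law \<theta>) {l<..<u} < measure (normal_law \<theta>) {l'<..<u'}"
proof (cases "l' < l")
  case True
  then show ?thesis using assms
    by (intro normal_law_strict_mono[where U="{l'<..<min l u'}"]) auto
next
  case False
  then show ?thesis using assms
    by (intro normal_law_strict_mono[where U="{max u l'<..<u'}"]) auto
qed

section \<open>Quantile and symmetric interval\<close>

text \<open>The description in \<open>z_quantile\<close> has a unique solution: the continuous
  \<open>cdf\<close> attains \<open>1 - \<alpha> / 2\<close>, and the upper tail is strictly
  decreasing. Symmetry then gives both tails the same mass.\<close>

lemma z_quantile_props:
  assumes "0 < \<alpha>" "\<alpha> < 1"
  defines "z \<equiv> z_quantile (\<alpha> / 2)"
  shows "0 < z" "measure (normal_law 0) {-z<..<z} = 1 - \<alpha>"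
proof -
  let ?M = "normal_law 0"
  have compl: "measure ?M {x<..} = 1 - cdf ?M x" for x
  proof -
    have "{x<..} = UNIV - {..x}" by auto
    then show ?thesis
      using normal_law.prob_compl[of "{..x}" 0] by (simp add: cdf_def)
  qed
  have "\<exists>x. cdf ?M x = 1 - \<alpha> / 2"
  proof -
    have "\<forall>\<^sub>F x in at_bot. cdf ?M x < 1 - \<alpha> / 2"
      using assms by (intro order_tendstoD(2)[OF normal_law.cdf_lim_at_bot]) auto
    then obtain p where p: "cdf ?M p < 1 - \<alpha> / 2"
      by (meson eventually_at_bot_linorder order_refl)
    have "\<forall>\<^sub>F x in at_top. cdf ?M x > 1 - \<alpha> / 2"
      using assms by (intro order_tendstoD(1)[OF normal_law.cdf_lim_at_top_prob]) auto
    then obtain q where q: "cdf ?M q > 1 - \<alpha> / 2"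
      by (meson eventually_at_top_linorder order_refl)
    have "p \<le> q" using p q normal_law.cdf_nondecreasing[of q p 0] by linarith
    then show ?thesis
      using IVT[of "cdf ?M" p "1 - \<alpha> / 2" q] p q
      by (auto simp: normal_law.isCont_cdf normal_law_finite_null)
  qed
  then obtain x where "cdf ?M x = 1 - \<alpha> / 2" ..
  then have x: "measure ?M {x<..} = \<alpha> / 2"
    using compl[of x] by simp
  have less: "measure ?M {b<..} < measure ?M {a<..}" if "a < b" for a b :: real
    using that by (intro normal_law_strict_mono[where U="{a<..<b}"]) auto
  have "measure ?M {z<..} = \<alpha> / 2"
    unfolding z_def z_quantile_def
    by (rule theI2[where a=x]) (use x less in \<open>auto, metis less_irrefl linorder_neqE\<close>)
  note z = this
  have symm: "measure ?M {..<-y} = measure ?M {y<..}" for y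
    by (subst measure_normal_law_uminus) (auto intro!: arg_cong[where f="measure ?M"])
  \<comment> \<open>For \<open>z \<le> 0\<close> the right half-line would have mass at most
    \<open>\<alpha> / 2 < 1 / 2\<close>, by symmetry also the left one; with the null point 0 the
    total would stay below 1.\<close>
  show "0 < z"
  proof (rule ccontr)
    assume "\<not> 0 < z"
    then have "measure ?M {0<..} \<le> measure ?M {z<..}"
      using less[of z 0] by (cases "z = 0") auto
    moreover have "measure ?M {..<0} = measure ?M {0<..}" using symm[of 0] by simp
    moreover have "measure ?M ({..<0} \<union> {0<..}) = measure ?M {..<0} + measure ?M {0<..}"
      by (rule normal_law.finite_measure_Union) auto
    moreover have "measure ?M (UNIV - ({..<0} \<union> {0<..})) = 1 - measure ?M ({..<0} \<union> {0<..})"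
      using normal_law.prob_compl[of "{..<0} \<union> {0<..}" 0] by simp
    moreover have "UNIV - ({..<0} \<union> {0<..}) = {0::real}" by auto
    ultimately show False using z assms normal_law_finite_null[of "{0}" 0] by simp
  qed
  have "measure ?M ({..<-z} \<union> {z<..}) = measure ?M {..<-z} + measure ?M {z<..}"
    using \<open>0 < z\<close> by (intro normal_law.finite_measure_Union) auto
  moreover have "measure ?M (({..<-z} \<union> {z<..}) \<union> {-z,z}) = measure ?M ({..<-z} \<union> {z<..}) + measure ?M {-z,z}"
    using \<open>0 < z\<close> by (intro normal_law.finite_measure_Union) auto
  moreover have "measure ?M (UNIV - (({..<-z} \<union> {z<..}) \<union> {-z,z})) = 1 - measure ?M (({..<-z} \<union> {z<..}) \<union> {-z,z})"
    using normal_law.prob_compl[of "({..<-z} \<union> {z<..}) \<union> {-z,z}" 0] by simp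
  moreover have "UNIV - (({..<-z} \<union> {z<..}) \<union> {-z,z}) = {-z<..<z}" by auto
  ultimately show "measure ?M {-z<..<z} = 1 - \<alpha>"
    using z symm[of z] normal_law_finite_null[of "{-z,z}" 0] by simp
qed

section \<open>The quotient, its sublevel sets and the level\<close>

text \<open>For \<open>a = w * sqrt (2 * pi)\<close> this is exactly the quotient in
  \<open>g\<close> at \<open>x = \<theta> + y\<close>; the second exponent is
  \<open>y\<^sup>2 / 2 - (\<theta> + y)\<^sup>2 / 2\<close>.\<close>

definition Q :: "real \<Rightarrow> real \<Rightarrow> real \<Rightarrow> real" where
  "Q a \<theta> y = a * exp (y\<^sup>2 / 2) + exp (- (\<theta>\<^sup>2 / 2 + \<theta> * y))"

lemma B_eq: "B w c \<theta> = {x. Q (w * sqrt (2 * pi)) \<theta> (x - \<theta>) < c}"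
proof -
  have "(w + std_normal_density x) / std_normal_density (x - \<theta>) = Q (w * sqrt (2 * pi)) \<theta> (x - \<theta>)" for x
  proof -
    have "exp (- (\<theta>\<^sup>2 / 2 + \<theta> * (x - \<theta>))) = exp (- x\<^sup>2 / 2) * exp ((x - \<theta>)\<^sup>2 / 2)"
      by (simp add: exp_add[symmetric]) (simp add: field_simps power2_eq_square)
    moreover have "exp (- (x - \<theta>)\<^sup>2 / 2) = 1 / exp ((x - \<theta>)\<^sup>2 / 2)"
      by (simp add: exp_minus inverse_eq_divide)
    ultimately show ?thesis
      by (simp add: Q_def std_normal_density_def field_simps)
  qed
  then show ?thesis by (simp add: B_def g_def)
qed

lemma Q_pos: "0 < a \<Longrightarrow> 0 < Q a \<theta> y"
  by (simp add: Q_def add_pos_pos)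

lemma Q_lower: "a * exp (y\<^sup>2 / 2) \<le> Q a \<theta> y"
  by (simp add: Q_def)

lemma Q_upper: "Q a \<theta> y \<le> (a + 1) * exp (y\<^sup>2 / 2)"
proof -
  have "- (\<theta>\<^sup>2 / 2 + \<theta> * y) = y\<^sup>2 / 2 - (\<theta> + y)\<^sup>2 / 2"
    by (simp add: power2_eq_square field_simps)
  also have "\<dots> \<le> y\<^sup>2 / 2" by simp
  finally show ?thesis by (simp add: Q_def algebra_simps)
qed

lemma continuous_on_Q [continuous_intros]: "continuous_on S (Q a \<theta>)"
  unfolding Q_def by (intro continuous_intros) auto

text \<open>The derivative \<open>D\<close> is strictly increasing, while a value at
  \<open>q\<close> no smaller than at \<open>p\<close> and \<open>r\<close> would force a
  nonnegative slope left of \<open>q\<close> and a nonpositive one right of it.\<close>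

lemma Q_strictly_quasiconvex:
  assumes a: "0 < a" and "p < q" "q < r"
  shows "Q a \<theta> q < max (Q a \<theta> p) (Q a \<theta> r)"
proof (rule ccontr)
  assume *: "\<not> ?thesis"
  define D where "D y = a * y * exp (y\<^sup>2 / 2) - \<theta> * exp (- (\<theta>\<^sup>2 / 2 + \<theta> * y))" for y
  have D: "(Q a \<theta> has_real_derivative D y) (at y)" for y
    unfolding Q_def D_def by (auto intro!: derivative_eq_intros simp: power2_eq_square algebra_simps)
  have D': "(D has_real_derivative
      a * (1 + y\<^sup>2) * exp (y\<^sup>2 / 2) + \<theta>\<^sup>2 * exp (- (\<theta>\<^sup>2 / 2 + \<theta> * y))) (at y)" for y
    unfolding D_def by (auto intro!: derivative_eq_intros simp: power2_eq_square algebra_simps)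
  obtain s where s: "p < s" "s < q" "Q a \<theta> q - Q a \<theta> p = (q - p) * D s"
    using MVT2[of p q "Q a \<theta>" D] D assms by auto
  obtain t where t: "q < t" "t < r" "Q a \<theta> r - Q a \<theta> q = (r - q) * D t"
    using MVT2[of q r "Q a \<theta>" D] D assms by auto
  have "0 < a * (1 + y\<^sup>2) * exp (y\<^sup>2 / 2) + \<theta>\<^sup>2 * exp (- (\<theta>\<^sup>2 / 2 + \<theta> * y))" for y
    using a by (intro add_pos_nonneg mult_pos_pos) (auto simp: add_pos_nonneg)
  then have "D s < D t"
    using s t D' by (intro DERIV_pos_imp_increasing[of s t D]) (simp, blast)
  moreover have "0 \<le> (q - p) * D s" "(r - q) * D t \<le> 0"
    using * s(3) t(3) by (auto simp: max_def split: if_splits)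
  then have "0 \<le> D s" "D t \<le> 0" using assms by (auto simp: zero_le_mult_iff mult_le_0_iff)
  ultimately show False by simp
qed

lemma Q_less_imp_abs_less:
  assumes "0 < a" "a * exp (r\<^sup>2 / 2) > Q a \<theta> y" "0 \<le> r"
  shows "\<bar>y\<bar> < r"
proof -
  have "a * exp (y\<^sup>2 / 2) < a * exp (r\<^sup>2 / 2)"
    using Q_lower[of a y \<theta>] assms by linarith
  then have "y\<^sup>2 < r\<^sup>2" using assms by simp
  then show ?thesis using assms(3) abs_less_iff power2_less_imp_less[of "\<bar>y\<bar>" r] by simp
qed

text \<open>No level occurs as a parameter: it is the common value of \<open>Q a \<theta>\<close> at
  both endpoints. The analysis of the endpoints then never mentions \<open>c_level\<close>.\<close>

definition level_interval :: "real \<Rightarrow> real \<Rightarrow> real \<Rightarrow> real \<Rightarrow> real \<Rightarrow> bool" where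
  "level_interval a \<alpha> \<theta> l u \<longleftrightarrow> l < u \<and> Q a \<theta> l = Q a \<theta> u \<and>
     (\<forall>y. Q a \<theta> y < Q a \<theta> u \<longleftrightarrow> l < y \<and> y < u) \<and> measure (normal_law 0) {l<..<u} = 1 - \<alpha>"

text \<open>The intermediate value theorem on both sides of a point \<open>y0\<close> of the set
  yields the endpoints; strict quasiconvexity fills the gap between them and excludes points beyond
  them.\<close>

lemma Q_sublevel_interval:
  assumes a: "0 < a" and ne: "{y. Q a \<theta> y < c} \<noteq> {}"
  obtains l u where "l < u" "{y. Q a \<theta> y < c} = {l<..<u}" "Q a \<theta> l = c" "Q a \<theta> u = c"
proof -
  let ?S = "{y. Q a \<theta> y < c}"
  obtain y0 where y0: "Q a \<theta> y0 < c" using ne by auto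
  \<comment> \<open>Large enough that \<open>y0\<close> lies between \<open>- R\<close> and
    \<open>R\<close> and that \<open>c < a * exp (R\<^sup>2 / 2)\<close>, since
    \<open>c / a < R < 1 + R\<^sup>2 / 2\<close>.\<close>
  define R where "R = \<bar>y0\<bar> + c / a + 1"
  have c: "0 < c" using Q_pos[OF a, of \<theta> y0] y0 by simp
  have R: "\<bar>y0\<bar> < R" "1 \<le> R" "c / a < R" using c a by (auto simp: R_def add_pos_nonneg)
  have "c < a * exp (R\<^sup>2 / 2)"
  proof -
    have "0 < (R - 1)\<^sup>2 + 1" by (simp add: add_nonneg_pos)
    then have "R < 1 + R\<^sup>2 / 2" by (simp add: power2_eq_square algebra_simps)
    also have "\<dots> \<le> exp (R\<^sup>2 / 2)" by (rule exp_ge_add_one_self)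
    finally have "c / a < exp (R\<^sup>2 / 2)" using R(3) by linarith
    then show ?thesis using a by (simp add: pos_divide_less_eq mult.commute)
  qed
  then have big: "c < Q a \<theta> R" "c < Q a \<theta> (-R)"
    using Q_lower[of a R \<theta>] Q_lower[of a "-R" \<theta>] by auto
  obtain u where u: "y0 \<le> u" "u \<le> R" "Q a \<theta> u = c"
    using IVT'[of "Q a \<theta>" y0 c R] y0 big R continuous_on_Q by (auto simp: abs_less_iff)
  obtain l where l: "-R \<le> l" "l \<le> y0" "Q a \<theta> l = c"
    using IVT2'[of "Q a \<theta>" y0 c "-R"] y0 big R continuous_on_Q by (auto simp: abs_less_iff)
  have lu: "l < y0" "y0 < u" using u l y0 by (auto simp: order_less_le)
  have "Q a \<theta> y < c \<longleftrightarrow> l < y \<and> y < u" for y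
  proof
    assume "l < y \<and> y < u"
    then show "Q a \<theta> y < c" using Q_strictly_quasiconvex[OF a, of l y u \<theta>] u l by simp
  next
    assume y: "Q a \<theta> y < c"
    have "\<not> y < l" using Q_strictly_quasiconvex[OF a, of y l y0 \<theta>] u l lu y y0 by auto
    moreover have "\<not> u < y" using Q_strictly_quasiconvex[OF a, of y0 u y \<theta>] u l lu y y0 by auto
    moreover have "y \<noteq> l" "y \<noteq> u" using y u l by auto
    ultimately show "l < y \<and> y < u" by auto
  qed
  then have "{y. Q a \<theta> y < c} = {l<..<u}" by (simp add: set_eq_iff)
  then show ?thesis by (rule that[OF less_trans[OF lu] _ l(3) u(3)])
qed

text \<open>The distribution \<open>M\<close> of \<open>Q a \<theta>\<close> under the standard
  normal law has no atoms, so its \<open>cdf\<close> is continuous and takes the value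
  \<open>1 - \<alpha>\<close>.\<close>

lemma Q_level_exists:
  assumes a: "0 < a" and \<alpha>: "0 < \<alpha>" "\<alpha> < 1"
  shows "\<exists>c. measure (normal_law 0) {y. Q a \<theta> y < c} = 1 - \<alpha>"
proof -
  let ?N = "normal_law 0"
  have meas [measurable]: "Q a \<theta> \<in> borel_measurable borel"
    by (intro borel_measurable_continuous_onI continuous_on_Q)
  define M where "M = distr ?N borel (Q a \<theta>)"
  interpret M: real_distribution M
    unfolding M_def by (rule normal_law.real_distribution_distr) simp
  \<comment> \<open>Three points on one level would violate strict quasiconvexity, so a level set
    has at most two points.\<close>
  have null: "measure ?N {y. Q a \<theta> y = c} = 0" for c
  proof (cases "\<exists>p q. p < q \<and> Q a \<theta> p = c \<and> Q a \<theta> q = c")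
    case True
    then obtain p q where pq: "p < q" "Q a \<theta> p = c" "Q a \<theta> q = c" by auto
    have "y = p \<or> y = q" if "Q a \<theta> y = c" for y
      using Q_strictly_quasiconvex[OF a, of p y q \<theta>] Q_strictly_quasiconvex[OF a, of y p q \<theta>]
        Q_strictly_quasiconvex[OF a, of p q y \<theta>] pq that
      by (cases y p rule: linorder_cases; cases y q rule: linorder_cases) auto
    then have "{y. Q a \<theta> y = c} \<subseteq> {p, q}" by auto
    then show ?thesis by (intro normal_law_finite_null) (auto intro: finite_subset)
  next
    case False
    then have uniq: "p = q" if "Q a \<theta> p = c" "Q a \<theta> q = c" for p q
      using that by (metis linorder_neqE)
    show ?thesis
    proof (cases "{y. Q a \<theta> y = c} = {}")
      case False
      then obtain p where "Q a \<theta> p = c" by auto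
      then have "{y. Q a \<theta> y = c} = {p}" using uniq by auto
      then show ?thesis by (simp add: normal_law_finite_null)
    qed simp
  qed
  have M_eq: "measure M {x. P x} = measure ?N {y. P (Q a \<theta> y)}" if "{x. P x} \<in> sets borel" for P
    unfolding M_def by (subst measure_distr) (use that in \<open>auto simp: vimage_def\<close>)
  have atom: "measure M {c} = 0" for c
    using M_eq[of "\<lambda>x. x = c"] null[of c] by simp
  have "\<forall>\<^sub>F x in at_bot. cdf M x < 1 - \<alpha>"
    using \<alpha> by (intro order_tendstoD(2)[OF M.cdf_lim_at_bot]) auto
  then obtain p where p: "cdf M p < 1 - \<alpha>"
    by (meson eventually_at_bot_linorder order_refl)
  have "\<forall>\<^sub>F x in at_top. cdf M x > 1 - \<alpha>"
    using \<alpha> by (intro order_tendstoD(1)[OF M.cdf_lim_at_top_prob]) auto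
  then obtain q where q: "cdf M q > 1 - \<alpha>"
    by (meson eventually_at_top_linorder order_refl)
  have "p \<le> q" using p q M.cdf_nondecreasing[of q p] by linarith
  then obtain c where c: "cdf M c = 1 - \<alpha>"
    using IVT[of "cdf M" p "1 - \<alpha>" q] p q by (auto simp: M.isCont_cdf atom)
  \<comment> \<open>\<open>cdf\<close> uses the weak inequality, the sublevel set the strict one;
    the point \<open>c\<close> carries no mass.\<close>
  have "{..c} = {..<c} \<union> {c}" by auto
  then have "cdf M c = measure M {..<c} + measure M {c}"
    unfolding cdf_def by (simp only:, subst M.finite_measure_Union) auto
  then have "measure M {x. x < c} = 1 - \<alpha>" using c atom by (simp add: lessThan_def)
  then show ?thesis using M_eq[of "\<lambda>x. x < c"] by (intro exI[of _ c]) simp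
qed

lemma measure_B:
  "measure (normal_law \<theta>) (B w c \<theta>) =
     measure (normal_law 0) {y. Q (w * sqrt (2 * pi)) \<theta> y < c}"
proof -
  have "{x. Q a \<theta> (x - \<theta>) < c} \<in> sets borel" for a
    unfolding Q_def by (intro borel_open open_Collect_less continuous_intros) auto
  then show ?thesis
    unfolding B_eq by (subst measure_normal_law_shift) auto
qed

text \<open>Besides existence, the description in \<open>c_level\<close> needs uniqueness: once a
  sublevel set is nonempty, raising the level moves both endpoints outward and so strictly increases
  the probability.\<close>

lemma acceptance_region_interval:
  fixes w \<alpha> \<theta> :: real
  assumes \<alpha>: "0 < \<alpha>" "\<alpha> < 1" and w: "0 < w"
  defines "a \<equiv> w * sqrt (2 * pi)"
  shows "\<exists>l u. level_interval a \<alpha> \<theta> l u \<and> acceptance_region w \<alpha> \<theta> = {\<theta> + l<..<\<theta> + u}"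
proof -
  have a: "0 < a" using w by (simp add: a_def)
  have mB: "measure (normal_law \<theta>) (B w c \<theta>) = measure (normal_law 0) {y. Q a \<theta> y < c}" for c
    unfolding a_def by (rule measure_B)
  obtain c where c: "measure (normal_law 0) {y. Q a \<theta> y < c} = 1 - \<alpha>"
    using Q_level_exists[OF a \<alpha>] by blast
  have ne: "{y. Q a \<theta> y < c'} \<noteq> {}" if "measure (normal_law 0) {y. Q a \<theta> y < c'} = 1 - \<alpha>" for c'
    using that \<alpha> by (metis diff_gt_0_iff_gt less_irrefl measure_empty)
  have less: "measure (normal_law 0) {y. Q a \<theta> y < c1} < measure (normal_law 0) {y. Q a \<theta> y < c2}"
    if c12: "c1 < c2" and ne1: "{y. Q a \<theta> y < c1} \<noteq> {}" for c1 c2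
  proof -
    obtain l u where lu: "l < u" "{y. Q a \<theta> y < c1} = {l<..<u}" "Q a \<theta> l = c1" "Q a \<theta> u = c1"
      by (rule Q_sublevel_interval[OF a ne1])
    have "u \<in> {y. Q a \<theta> y < c2}" using lu c12 by simp
    then obtain l' u' where lu': "l' < u'" "{y. Q a \<theta> y < c2} = {l'<..<u'}"
      by (metis Q_sublevel_interval[OF a] empty_iff)
    have "l \<in> {y. Q a \<theta> y < c2}" "u \<in> {y. Q a \<theta> y < c2}" using lu c12 by auto
    then have "l' < l" "u < u'" using lu' by auto
    then show ?thesis using lu lu' by (auto intro: normal_law_interval_less)
  qed
  have cpos: "0 < c'" if "{y. Q a \<theta> y < c'} \<noteq> {}" for c'
    using that Q_pos[OF a, of \<theta>] by (auto intro: less_trans)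
  have c_level: "c_level w \<alpha> \<theta> = c"
    unfolding c_level_def mB
  proof (rule the_equality)
    show "0 < c \<and> measure (normal_law 0) {y. Q a \<theta> y < c} = 1 - \<alpha>" using c ne cpos by blast
    fix c' assume "0 < c' \<and> measure (normal_law 0) {y. Q a \<theta> y < c'} = 1 - \<alpha>"
    then show "c' = c" using less[of c c'] less[of c' c] ne c by (cases c' c rule: linorder_cases) auto
  qed
  obtain l u where lu: "l < u" "{y. Q a \<theta> y < c} = {l<..<u}" "Q a \<theta> l = c" "Q a \<theta> u = c"
    by (rule Q_sublevel_interval[OF a ne[OF c]])
  have iff: "Q a \<theta> y < c \<longleftrightarrow> l < y \<and> y < u" for y
    using lu(2) by (auto simp: set_eq_iff)
  have "measure (normal_law 0) {l<..<u} = 1 - \<alpha>" using c unfolding lu(2) .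
  then have "level_interval a \<alpha> \<theta> l u"
    using lu(1,3,4) iff by (simp add: level_interval_def)
  moreover have "acceptance_region w \<alpha> \<theta> = {\<theta> + l<..<\<theta> + u}"
    unfolding acceptance_region_def B_eq a_def[symmetric] c_level iff by auto
  ultimately show ?thesis by blast
qed


section \<open>Reflection symmetry\<close>

lemma Q_uminus: "Q a (- \<theta>) (- y) = Q a \<theta> y"
  by (simp add: Q_def)

text \<open>\<open>Q\<close> is invariant under a joint change of sign of its last two arguments and
  the standard normal law is symmetric, so \<open>c_level\<close> is even in \<theta>.\<close>

lemma confidence_set_uminus: "confidence_set w \<alpha> (- x) = uminus ` confidence_set w \<alpha> x"
proof -
  have B: "- x \<in> B w c (- \<theta>) \<longleftrightarrow> x \<in> B w c \<theta>" for x c \<theta>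
    using Q_uminus[of _ \<theta> "x - \<theta>"] by (simp add: B_eq)
  have "measure (normal_law (- \<theta>)) (B w c (- \<theta>)) = measure (normal_law \<theta>) (B w c \<theta>)" for \<theta> c
  proof -
    define a where "a = w * sqrt (2 * pi)"
    have "{y. Q a (- \<theta>) y < c} \<in> sets borel"
      by (intro borel_open open_Collect_less continuous_on_Q continuous_intros)
    then have "measure (normal_law 0) {y. Q a (- \<theta>) y < c} =
        measure (normal_law 0) {y. Q a (- \<theta>) (- y) < c}"
      by (subst measure_normal_law_uminus) auto
    then show ?thesis by (simp add: measure_B Q_uminus a_def)
  qed
  then have "c_level w \<alpha> (- \<theta>) = c_level w \<alpha> \<theta>" for \<theta>
    by (simp add: c_level_def)
  then have "\<theta> \<in> confidence_set w \<alpha> (- x) \<longleftrightarrow> - \<theta> \<in> confidence_set w \<alpha> x" for \<theta>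
    using B[of x _ "- \<theta>"] by (simp add: confidence_set_def acceptance_region_def)
  then show ?thesis by (auto simp: minus_image_eq_vimage)
qed

text \<open>The slope of \<open>exp\<close> is at least 1 on the nonnegative reals. The estimate
  relates differences of levels to differences of squared endpoints.\<close>

lemma exp_sq_diff_ge:
  fixes s t :: real
  assumes "t\<^sup>2 \<le> s\<^sup>2"
  shows "(s\<^sup>2 - t\<^sup>2) / 2 \<le> exp (s\<^sup>2 / 2) - exp (t\<^sup>2 / 2)"
proof -
  let ?d = "(s\<^sup>2 - t\<^sup>2) / 2"
  have "1 * ?d \<le> exp (t\<^sup>2 / 2) * ?d" using assms by (intro mult_right_mono) auto
  also have "\<dots> \<le> exp (t\<^sup>2 / 2) * (exp ?d - 1)"
    using exp_ge_add_one_self[of ?d] by (intro mult_left_mono; linarith?) simp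
  also have "\<dots> = exp (t\<^sup>2 / 2 + ?d) - exp (t\<^sup>2 / 2)"
    by (simp add: exp_add algebra_simps)
  also have "t\<^sup>2 / 2 + ?d = s\<^sup>2 / 2" by (simp add: field_simps)
  finally show ?thesis by simp
qed

lemma level_intervalD:
  assumes "level_interval a \<alpha> \<theta> l u"
  shows "l < u" "Q a \<theta> l = Q a \<theta> u" "Q a \<theta> y < Q a \<theta> u \<longleftrightarrow> l < y \<and> y < u"
    "measure (normal_law 0) {l<..<u} = 1 - \<alpha>"
  using assms unfolding level_interval_def by blast+

text \<open>Two intervals of equal mass are never strictly nested, even when they belong to
  different parameters.\<close>

lemma level_interval_shift_iff:
  assumes "level_interval a \<alpha> \<theta> l u" "level_interval a \<alpha> \<theta>' l' u'"
  shows "l < l' \<longleftrightarrow> u < u'"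
proof -
  note D = level_intervalD[OF assms(1)] level_intervalD[OF assms(2)]
  show ?thesis
    using normal_law_interval_less[of l' l u u' 0] normal_law_interval_less[of l l' u' u 0]
      D(1,4,5,8) by linarith
qed

section \<open>Uniform bounds and limits of the endpoints\<close>

text \<open>\<open>z\<close> is known here only through its sign and the mass of the symmetric
  interval; \<open>a\<close> stands for \<open>w * sqrt (2 * pi)\<close>.\<close>

locale level_intervals =
  fixes a \<alpha> z :: real
  assumes a: "0 < a" and z: "0 < z" and z_mass: "measure (normal_law 0) {-z<..<z} = 1 - \<alpha>"
begin

text \<open>A level above \<open>K\<close> would put both \<open>z\<close> and \<open>- z\<close>
  strictly between \<open>l\<close> and \<open>u\<close>, giving a mass above
  \<open>1 - \<alpha>\<close>.\<close>

lemma level_le: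
  assumes "level_interval a \<alpha> \<theta> l u" and K: "\<And>y. \<bar>y\<bar> \<le> z \<Longrightarrow> Q a \<theta> y \<le> K"
  shows "Q a \<theta> u \<le> K"
proof (rule ccontr)
  assume "\<not> ?thesis"
  then have "Q a \<theta> z < Q a \<theta> u" "Q a \<theta> (- z) < Q a \<theta> u"
    using K[of z] K[of "- z"] z by auto
  then have "l < - z" "z < u"
    using level_intervalD(3)[OF assms(1)] by blast+
  then have "measure (normal_law 0) {-z<..<z} < measure (normal_law 0) {l<..<u}"
    using z by (intro normal_law_interval_less) auto
  then show False using level_intervalD(4)[OF assms(1)] z_mass by simp
qed

text \<open>A smaller level would put both endpoints strictly between \<open>- z\<close> and
  \<open>z\<close>, leaving too little mass.\<close>

lemma level_ge:
  assumes "level_interval a \<alpha> \<theta> l u"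
  shows "a * exp (z\<^sup>2 / 2) \<le> Q a \<theta> u"
proof (rule ccontr)
  assume *: "\<not> ?thesis"
  have "\<bar>u\<bar> < z" "\<bar>l\<bar> < z"
    using * level_intervalD(2)[OF assms] z by (auto intro!: Q_less_imp_abs_less[OF a, of \<theta>])
  then have "measure (normal_law 0) {l<..<u} < measure (normal_law 0) {-z<..<z}"
    using z by (intro normal_law_interval_less) auto
  then show False using level_intervalD(4)[OF assms(1)] z_mass by simp
qed

text \<open>\<open>a * M\<close> is the bound of \<open>Q_upper\<close> at \<open>z\<close>, hence a
  bound for every level; since \<open>M < exp (M\<^sup>2 / 2)\<close>, the same \<open>M\<close>
  bounds the endpoints.\<close>

definition M :: real where
  "M = (a + 1) / a * exp (z\<^sup>2 / 2)"

lemma level_interval_bounded: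
  assumes "level_interval a \<alpha> \<theta> l u"
  shows "\<bar>l\<bar> < M" "\<bar>u\<bar> < M"
proof -
  have M: "0 < M" using a by (simp add: M_def)
  have "0 < (M - 1)\<^sup>2 + 1" by (simp add: add_nonneg_pos)
  then have "M < 1 + M\<^sup>2 / 2" by (simp add: power2_eq_square algebra_simps)
  also have "\<dots> \<le> exp (M\<^sup>2 / 2)" by (rule exp_ge_add_one_self)
  finally have "a * M < a * exp (M\<^sup>2 / 2)" using a by simp
  moreover have "Q a \<theta> u \<le> a * M"
  proof (rule level_le[OF assms])
    fix y :: real assume "\<bar>y\<bar> \<le> z"
    then have "y\<^sup>2 \<le> z\<^sup>2" using z by (simp add: abs_le_square_iff[symmetric])
    then have "(a + 1) * exp (y\<^sup>2 / 2) \<le> (a + 1) * exp (z\<^sup>2 / 2)" using a by simp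
    also have "(a + 1) * exp (z\<^sup>2 / 2) = a * M" using a by (simp add: M_def)
    finally show "Q a \<theta> y \<le> a * M" using Q_upper[of a \<theta> y] by linarith
  qed
  ultimately show "\<bar>l\<bar> < M" "\<bar>u\<bar> < M"
    using M level_intervalD(2)[OF assms] by (auto intro!: Q_less_imp_abs_less[OF a, of \<theta>])
qed

lemma z_less_M: "z < M"
proof -
  have "0 < (z - 1)\<^sup>2 + 1" by (simp add: add_nonneg_pos)
  then have "z < 1 + z\<^sup>2 / 2" by (simp add: power2_eq_square algebra_simps)
  also have "\<dots> \<le> exp (z\<^sup>2 / 2)" by (rule exp_ge_add_one_self)
  also have "\<dots> \<le> M" unfolding M_def using a by (simp add: field_simps)
  finally show ?thesis .
qed

lemma perturbation_le:
  assumes "\<bar>y\<bar> \<le> M" "0 \<le> \<theta>"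
  shows "exp (- (\<theta>\<^sup>2 / 2 + \<theta> * y)) \<le> exp (- (\<theta>\<^sup>2 / 2 - \<theta> * M))"
proof -
  have "\<theta> * (- M) \<le> \<theta> * y" using assms by (intro mult_left_mono) auto
  then show ?thesis by simp
qed

text \<open>For large \<theta> the level exceeds \<open>a * exp (z\<^sup>2 / 2)\<close> by at most
  \<open>\<eta>\<close>, and the perturbation at \<open>l\<close> and \<open>u\<close> is below
  \<open>\<eta>\<close>. So \<open>a * exp (y\<^sup>2 / 2)\<close> at the endpoints is within
  \<open>\<eta>\<close> of its value at \<open>z\<close>.\<close>

lemma level_interval_tendsto:
  assumes \<epsilon>: "0 < \<epsilon>"
  shows "\<forall>\<^sub>F \<theta> in at_top. \<forall>l u. level_interval a \<alpha> \<theta> l u \<longrightarrow> \<bar>u - z\<bar> < \<epsilon> \<and> \<bar>l + z\<bar> < \<epsilon>"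
proof -
  \<comment> \<open>The first bound yields distance below \<open>\<epsilon>\<close>; the second
    keeps \<open>Q a \<theta> 0\<close> below the level, so that 0 lies between \<open>l\<close> and
    \<open>u\<close> and their signs are known.\<close>
  define \<eta> where "\<eta> = min (a * z * \<epsilon> / 2) (a * (exp (z\<^sup>2 / 2) - 1))"
  have \<eta>: "0 < \<eta>" using a z \<epsilon> by (simp add: \<eta>_def)
  have "((\<lambda>\<theta>. exp (- (\<theta>\<^sup>2 / 2 - \<theta> * M))) \<longlongrightarrow> 0) at_top"
    using z z_less_M by real_asymp
  then have "\<forall>\<^sub>F \<theta> in at_top. exp (- (\<theta>\<^sup>2 / 2 - \<theta> * M)) < \<eta>"
    using \<eta> by (rule order_tendstoD)
  then show ?thesis using eventually_ge_at_top[of 0]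
  proof (eventually_elim, intro allI impI)
    fix \<theta> l u assume small: "exp (- (\<theta>\<^sup>2 / 2 - \<theta> * M)) < \<eta>" and \<theta>: "0 \<le> \<theta>"
      and li: "level_interval a \<alpha> \<theta> l u"
    have Q: "Q a \<theta> y < a * exp (y\<^sup>2 / 2) + \<eta>" if "\<bar>y\<bar> \<le> M" for y
      using perturbation_le[OF that \<theta>] small unfolding Q_def by linarith
    have le: "Q a \<theta> u \<le> a * exp (z\<^sup>2 / 2) + \<eta>"
    proof (rule level_le[OF li])
      fix y :: real assume y: "\<bar>y\<bar> \<le> z"
      then have "y\<^sup>2 \<le> z\<^sup>2" using z by (simp add: abs_le_square_iff[symmetric])
      then have "a * exp (y\<^sup>2 / 2) \<le> a * exp (z\<^sup>2 / 2)" using a by simp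
      then show "Q a \<theta> y \<le> a * exp (z\<^sup>2 / 2) + \<eta>" using Q[of y] y z_less_M by simp
    qed
    have ge: "a * exp (z\<^sup>2 / 2) \<le> Q a \<theta> u" by (rule level_ge[OF li])
    have "Q a \<theta> 0 < a + \<eta>" using Q[of 0] z z_less_M by simp
    also have "\<dots> \<le> a * exp (z\<^sup>2 / 2)" by (simp add: \<eta>_def min_def algebra_simps)
    also note ge
    finally have "l < 0" "0 < u" using level_intervalD(3)[OF li] by blast+
    \<comment> \<open>Factoring \<open>p\<^sup>2 - z\<^sup>2\<close> and using
      \<open>p + z > z\<close> turns a bound on the difference of squares into one on
      \<open>p - z\<close>.\<close>
    have close: "\<bar>p - z\<bar> < \<epsilon>" if p: "0 < p" "\<bar>a * exp (p\<^sup>2 / 2) - a * exp (z\<^sup>2 / 2)\<bar> \<le> \<eta>" for p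
    proof -
      have "a * (\<bar>p\<^sup>2 - z\<^sup>2\<bar> / 2) \<le> a * \<bar>exp (p\<^sup>2 / 2) - exp (z\<^sup>2 / 2)\<bar>"
        using a exp_sq_diff_ge[of z p] exp_sq_diff_ge[of p z] by (intro mult_left_mono) (auto simp: abs_if)
      also have "\<dots> = \<bar>a * exp (p\<^sup>2 / 2) - a * exp (z\<^sup>2 / 2)\<bar>"
        using a by (simp add: right_diff_distrib[symmetric] abs_mult)
      also have "\<dots> \<le> a * z * \<epsilon> / 2" using p(2) by (simp add: \<eta>_def)
      finally have "\<bar>p\<^sup>2 - z\<^sup>2\<bar> \<le> z * \<epsilon>" using a by (simp add: field_simps)
      moreover have "\<bar>p\<^sup>2 - z\<^sup>2\<bar> = \<bar>p - z\<bar> * (p + z)"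
        using p z by (simp add: power2_eq_square square_diff_square_factored abs_mult)
      ultimately have le: "\<bar>p - z\<bar> * (p + z) \<le> \<epsilon> * z" by (simp add: mult.commute)
      show ?thesis
      proof (rule ccontr)
        assume "\<not> ?thesis"
        then have "\<epsilon> * (p + z) \<le> \<bar>p - z\<bar> * (p + z)" using p z by (intro mult_right_mono) auto
        moreover have "\<epsilon> * z < \<epsilon> * (p + z)" using \<epsilon> p by simp
        ultimately show False using le by linarith
      qed
    qed
    have "\<bar>u - z\<bar> < \<epsilon>"
      using le ge Q[of u] Q_lower[of a u \<theta>] level_interval_bounded[OF li] \<open>0 < u\<close>
      by (intro close) (auto simp: abs_le_iff)
    moreover have "\<bar>- l - z\<bar> < \<epsilon>"
      using le ge Q[of l] Q_lower[of a l \<theta>] level_interval_bounded[OF li] \<open>l < 0\<close> level_intervalD(2)[OF li]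
      by (intro close) (auto simp: abs_le_iff)
    ultimately show "\<bar>u - z\<bar> < \<epsilon> \<and> \<bar>l + z\<bar> < \<epsilon>" by linarith
  qed
qed

section \<open>Monotonicity of the shifted endpoints\<close>

text \<open>The derivative in \<theta> is \<open>- (\<theta> + y)\<close> times the perturbation:
  nonpositive for \<open>\<bar>y\<bar> \<le> M \<le> \<theta>\<close>, and of size at most
  \<open>\<kappa>\<close>.\<close>

lemma perturbation_decreasing:
  assumes y: "\<bar>y\<bar> \<le> M" and "M \<le> \<theta>1" "\<theta>1 < \<theta>2"
    and \<kappa>: "\<And>\<theta>. \<theta>1 \<le> \<theta> \<Longrightarrow> (\<theta> + M) * exp (- (\<theta>\<^sup>2 / 2 - \<theta> * M)) \<le> \<kappa>"
  shows "exp (- (\<theta>2\<^sup>2 / 2 + \<theta>2 * y)) \<le> exp (- (\<theta>1\<^sup>2 / 2 + \<theta>1 * y))"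
    and "exp (- (\<theta>1\<^sup>2 / 2 + \<theta>1 * y)) - exp (- (\<theta>2\<^sup>2 / 2 + \<theta>2 * y)) \<le> \<kappa> * (\<theta>2 - \<theta>1)"
proof -
  let ?e = "\<lambda>t. exp (- (t\<^sup>2 / 2 + t * y))"
  have "(?e has_real_derivative - ((t + y) * ?e t)) (at t)" for t
    by (auto intro!: derivative_eq_intros simp: power2_eq_square algebra_simps)
  then obtain \<xi> where \<xi>: "\<theta>1 < \<xi>" "?e \<theta>2 - ?e \<theta>1 = (\<theta>2 - \<theta>1) * - ((\<xi> + y) * ?e \<xi>)"
    using MVT2[of \<theta>1 \<theta>2 ?e "\<lambda>t. - ((t + y) * ?e t)"] assms by blast
  have nonneg: "0 \<le> \<xi> + y" "0 \<le> \<xi>" using assms \<xi> z z_less_M by linarith+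
  have "(\<xi> + y) * ?e \<xi> \<le> (\<xi> + M) * exp (- (\<xi>\<^sup>2 / 2 - \<xi> * M))"
    using nonneg y perturbation_le[OF y nonneg(2)] by (intro mult_mono) auto
  also have "\<dots> \<le> \<kappa>" using \<kappa> \<xi> by simp
  finally have "(\<theta>2 - \<theta>1) * ((\<xi> + y) * ?e \<xi>) \<le> (\<theta>2 - \<theta>1) * \<kappa>"
    using assms by (intro mult_left_mono) auto
  then show "?e \<theta>1 - ?e \<theta>2 \<le> \<kappa> * (\<theta>2 - \<theta>1)" using \<xi>(2) by (simp add: mult.commute)
  have "0 \<le> (\<theta>2 - \<theta>1) * ((\<xi> + y) * ?e \<xi>)" using nonneg assms by simp
  then show "?e \<theta>2 \<le> ?e \<theta>1" using \<xi>(2) unfolding mult_minus_right by linarith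
qed

text \<open>The derivative in \<open>y\<close> is \<open>- \<theta>\<close> times the perturbation,
  and \<open>\<theta> \<le> \<theta> + M\<close> lets the same \<open>\<kappa>\<close> serve for
  both variables.\<close>

lemma perturbation_diff_le:
  assumes y: "\<bar>p\<bar> \<le> M" "\<bar>q\<bar> \<le> M" "p < q" and "M \<le> \<theta>"
    and \<kappa>: "(\<theta> + M) * exp (- (\<theta>\<^sup>2 / 2 - \<theta> * M)) \<le> \<kappa>"
  shows "exp (- (\<theta>\<^sup>2 / 2 + \<theta> * p)) - exp (- (\<theta>\<^sup>2 / 2 + \<theta> * q)) \<le> \<kappa> * (q - p)"
proof -
  let ?e = "\<lambda>y. exp (- (\<theta>\<^sup>2 / 2 + \<theta> * y))"
  have M: "0 < M" using z z_less_M by simp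
  have "(?e has_real_derivative - (\<theta> * ?e t)) (at t)" for t
    by (auto intro!: derivative_eq_intros)
  then obtain \<xi> where \<xi>: "p < \<xi>" "\<xi> < q" "?e q - ?e p = (q - p) * - (\<theta> * ?e \<xi>)"
    using MVT2[of p q ?e "\<lambda>t. - (\<theta> * ?e t)"] y by blast
  have "\<theta> * ?e \<xi> \<le> (\<theta> + M) * exp (- (\<theta>\<^sup>2 / 2 - \<theta> * M))"
    using y \<xi> assms M by (intro mult_mono perturbation_le) auto
  also note \<kappa>
  finally have "(q - p) * (\<theta> * ?e \<xi>) \<le> (q - p) * \<kappa>"
    using y by (intro mult_left_mono) auto
  then show ?thesis using \<xi>(3) by (simp add: mult.commute)
qed

lemma level_interval_mono:
  "\<forall>\<^sub>F \<theta>1 in at_top. \<forall>\<theta>2 l1 u1 l2 u2. \<theta>1 < \<theta>2 \<longrightarrow> level_interval a \<alpha> \<theta>1 l1 u1 \<longrightarrow>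
     level_interval a \<alpha> \<theta>2 l2 u2 \<longrightarrow> \<theta>1 + l1 \<le> \<theta>2 + l2 \<and> \<theta>1 + u1 \<le> \<theta>2 + u2"
proof -
  \<comment> \<open>The divisor 8 makes \<open>a * (z / 2)\<close> equal to
    \<open>4 * \<kappa>\<close>, which leaves room to absorb the term
    \<open>\<kappa> * (u1 - u2)\<close> from the perturbation.\<close>
  define \<kappa> where "\<kappa> = a * z / 8"
  have \<kappa>: "0 < \<kappa>" using a z by (simp add: \<kappa>_def)
  have M: "0 < M" using z z_less_M by simp
  have "((\<lambda>\<theta>. (\<theta> + M) * exp (- (\<theta>\<^sup>2 / 2 - \<theta> * M))) \<longlongrightarrow> 0) at_top"
    using M by real_asymp
  then have "\<forall>\<^sub>F \<theta> in at_top. (\<theta> + M) * exp (- (\<theta>\<^sup>2 / 2 - \<theta> * M)) < \<kappa>"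
    using \<kappa> by (rule order_tendstoD)
  \<comment> \<open>This tolerance keeps the endpoints at distance more than \<open>z / 2\<close>
    from 0, where \<open>exp (y\<^sup>2 / 2)\<close> is flat.\<close>
  moreover have "0 < z / 2" using z by simp
  note level_interval_tendsto[OF this]
  ultimately have "\<forall>\<^sub>F \<theta> in at_top. (\<theta> + M) * exp (- (\<theta>\<^sup>2 / 2 - \<theta> * M)) \<le> \<kappa> \<and>
      (\<forall>l u. level_interval a \<alpha> \<theta> l u \<longrightarrow> \<bar>u - z\<bar> < z / 2 \<and> \<bar>l + z\<bar> < z / 2)"
    by eventually_elim auto
  then obtain T where T: "\<And>\<theta>. T \<le> \<theta> \<Longrightarrow> (\<theta> + M) * exp (- (\<theta>\<^sup>2 / 2 - \<theta> * M)) \<le> \<kappa>"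
      "\<And>\<theta> l u. T \<le> \<theta> \<Longrightarrow> level_interval a \<alpha> \<theta> l u \<Longrightarrow> \<bar>u - z\<bar> < z / 2 \<and> \<bar>l + z\<bar> < z / 2"
    by (auto simp: eventually_at_top_linorder)
  show ?thesis
  proof (rule eventually_mono[OF eventually_ge_at_top[of "max T M"]], intro allI impI)
    fix \<theta>1 \<theta>2 l1 u1 l2 u2
    assume "max T M \<le> \<theta>1" and less: "\<theta>1 < \<theta>2"
      and li1: "level_interval a \<alpha> \<theta>1 l1 u1" and li2: "level_interval a \<alpha> \<theta>2 l2 u2"
    then have \<theta>: "T \<le> \<theta>1" "M \<le> \<theta>1" "T \<le> \<theta>2" "M \<le> \<theta>2" by auto
    note iff = level_interval_shift_iff[OF li2 li1]
    show "\<theta>1 + l1 \<le> \<theta>2 + l2 \<and> \<theta>1 + u1 \<le> \<theta>2 + u2"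
      \<comment> \<open>If the endpoints move left by \<open>u1 - u2\<close> and \<open>l1 - l2\<close>, then \<open>a * exp (y\<^sup>2 / 2)\<close> unbalances the
        equation \<open>Q a \<theta> l = Q a \<theta> u\<close> by at least \<open>4 * \<kappa>\<close> times the sum of these moves. The perturbation can
        compensate for this only if \<open>\<theta>2 - \<theta>1\<close> is at least as large.\<close>
    proof (cases "u2 < u1")
      case False
      then show ?thesis using iff less by auto
    next
      case True
      then have "l2 < l1" using iff by simp
      let ?E = "\<lambda>y. exp (y\<^sup>2 / 2)" and ?e = "\<lambda>\<theta> y. exp (- (\<theta>\<^sup>2 / 2 + \<theta> * y))"
      note bd = level_interval_bounded[OF li1] level_interval_bounded[OF li2]
      note near = T(2)[OF \<theta>(1) li1] T(2)[OF \<theta>(3) li2]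
      have eq: "a * ?E l1 + ?e \<theta>1 l1 = a * ?E u1 + ?e \<theta>1 u1"
        "a * ?E l2 + ?e \<theta>2 l2 = a * ?E u2 + ?e \<theta>2 u2"
        using level_intervalD(2)[OF li1] level_intervalD(2)[OF li2] by (simp_all add: Q_def)
      have half: "z / 2 < u1" "z / 2 < u2" "l1 < - (z / 2)" "l2 < - (z / 2)"
        using near unfolding abs_less_iff by linarith+
      have "0 < u2" "l1 < 0" using half z by linarith+
      have mid: "z / 2 \<le> (u1 + u2) / 2" "z / 2 \<le> (- l1 - l2) / 2"
        using half z by (simp_all add: field_simps)
      have "z / 2 * (u1 - u2) \<le> (u1 + u2) / 2 * (u1 - u2)"
        using mid True by (intro mult_right_mono) auto
      also have "\<dots> = (u1\<^sup>2 - u2\<^sup>2) / 2" by (simp add: power2_eq_square field_simps)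
      also have "\<dots> \<le> ?E u1 - ?E u2" by (rule exp_sq_diff_ge[OF power_mono])
        (use \<open>0 < u2\<close> True in auto)
      finally have u: "a * (z / 2 * (u1 - u2)) \<le> a * (?E u1 - ?E u2)" using a by simp
      have "z / 2 * (l1 - l2) \<le> (- l1 - l2) / 2 * (l1 - l2)"
        using mid \<open>l2 < l1\<close> by (intro mult_right_mono) auto
      also have "\<dots> = ((- l2)\<^sup>2 - (- l1)\<^sup>2) / 2" by (simp add: power2_eq_square field_simps)
      also have "\<dots> \<le> ?E (- l2) - ?E (- l1)" by (rule exp_sq_diff_ge[OF power_mono])
        (use \<open>l1 < 0\<close> \<open>l2 < l1\<close> in auto)
      finally have l: "a * (z / 2 * (l1 - l2)) \<le> a * (?E l2 - ?E l1)" using a by simp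
      have scale: "a * (z / 2 * d) = \<kappa> * (4 * d)" for d by (simp add: \<kappa>_def)
      \<comment> \<open>Subtracting the two equations in \<open>eq\<close> leaves two perturbation
        differences. One is bounded by going from \<open>\<theta>1\<close> to
        \<open>\<theta>2\<close> at \<open>l1\<close> and then from \<open>l1\<close> to
        \<open>l2\<close>, the other by going from \<open>\<theta>2\<close> to
        \<open>\<theta>1\<close> at \<open>u2\<close> and then from \<open>u2\<close> to
        \<open>u1\<close>.\<close>
      have "?e \<theta>1 l1 - ?e \<theta>2 l1 \<le> \<kappa> * (\<theta>2 - \<theta>1)"
        using bd \<theta> less T(1) by (intro perturbation_decreasing(2)) auto
      moreover have "?e \<theta>2 l1 \<le> ?e \<theta>2 l2"
        using \<open>l2 < l1\<close> \<theta> M by simp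
      moreover have "?e \<theta>2 u2 \<le> ?e \<theta>1 u2"
        using bd \<theta> less T(1) by (intro perturbation_decreasing(1)[where \<kappa>=\<kappa>]) auto
      moreover have "?e \<theta>1 u2 - ?e \<theta>1 u1 \<le> \<kappa> * (u1 - u2)"
        using bd \<theta> True T(1) by (intro perturbation_diff_le) auto
      ultimately have "a * (z / 2 * (u1 - u2)) + a * (z / 2 * (l1 - l2)) \<le> \<kappa> * (\<theta>2 - \<theta>1) + \<kappa> * (u1 - u2)"
        using u l eq unfolding right_diff_distrib[of a] by linarith
      then have "\<kappa> * (4 * ((u1 - u2) + (l1 - l2))) \<le> \<kappa> * ((\<theta>2 - \<theta>1) + (u1 - u2))"
        by (simp only: scale distrib_left)
      then have "4 * ((u1 - u2) + (l1 - l2)) \<le> (\<theta>2 - \<theta>1) + (u1 - u2)" using \<kappa> by simp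
      then show ?thesis using True \<open>l2 < l1\<close> by (simp add: algebra_simps)
    qed
  qed
qed

end

section \<open>Confidence sets for large observations\<close>

text \<open>For large \<open>x\<close> the set \<open>C x\<close> contains
  \<open>{x - z + \<delta>..x + z - \<delta>}\<close> and lies in
  \<open>{x - z - \<delta><..<x + z + \<delta>}\<close>, which locates both endpoints.\<close>

lemma confidence_set_at_top:
  fixes w \<alpha> :: real
  assumes \<alpha>: "0 < \<alpha>" "\<alpha> < 1" and w: "0 < w" and \<epsilon>: "0 < \<epsilon>"
  defines "z \<equiv> z_quantile (\<alpha> / 2)" and "C \<equiv> confidence_set w \<alpha>"
  shows "\<forall>\<^sub>F x in at_top. is_interval (C x) \<and> C x \<noteq> {} \<and> bounded (C x) \<and>
    \<bar>Inf (C x) - (x - z)\<bar> \<le> \<epsilon> \<and> \<bar>Sup (C x) - (x + z)\<bar> \<le> \<epsilon>"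
proof -
  define a where "a = w * sqrt (2 * pi)"
  note zp = z_quantile_props[OF \<alpha>, folded z_def]
  interpret level_intervals a \<alpha> z
    by standard (use w zp in \<open>auto simp: a_def\<close>)
  obtain l u where li: "\<And>\<theta>. level_interval a \<alpha> \<theta> (l \<theta>) (u \<theta>)"
      and acc: "\<And>\<theta>. acceptance_region w \<alpha> \<theta> = {\<theta> + l \<theta><..<\<theta> + u \<theta>}"
    using acceptance_region_interval[OF \<alpha> w] unfolding a_def by metis
  have C: "\<theta> \<in> C x \<longleftrightarrow> \<theta> + l \<theta> < x \<and> x < \<theta> + u \<theta>" for x \<theta>
    by (simp add: C_def confidence_set_def acc)
  have bd: "\<bar>l \<theta>\<bar> < M" "\<bar>u \<theta>\<bar> < M" for \<theta>
    using level_interval_bounded[OF li] by auto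
  \<comment> \<open>\<open>\<delta> < z\<close> makes \<open>x\<close> itself satisfy the conditions
    of \<open>inner\<close>, so that \<open>C x\<close> is nonempty.\<close>
  define \<delta> where "\<delta> = min \<epsilon> (z / 2)"
  have \<delta>: "0 < \<delta>" "\<delta> \<le> \<epsilon>" "\<delta> < z" using \<epsilon> z by (auto simp: \<delta>_def min_def)
  obtain T1 where T1: "\<And>\<theta>. T1 \<le> \<theta> \<Longrightarrow> \<bar>u \<theta> - z\<bar> < \<delta> \<and> \<bar>l \<theta> + z\<bar> < \<delta>"
    using level_interval_tendsto[OF \<delta>(1)] li unfolding eventually_at_top_linorder by metis
  obtain T2 where T2: "\<And>\<theta>1 \<theta>2. T2 \<le> \<theta>1 \<Longrightarrow> \<theta>1 < \<theta>2 \<Longrightarrow>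
      \<theta>1 + l \<theta>1 \<le> \<theta>2 + l \<theta>2 \<and> \<theta>1 + u \<theta>1 \<le> \<theta>2 + u \<theta>2"
    using level_interval_mono li unfolding eventually_at_top_linorder by metis
  show ?thesis
  proof (rule eventually_mono[OF eventually_ge_at_top[of "max T1 T2 + M"]])
    \<comment> \<open>Elements of \<open>C x\<close> differ from \<open>x\<close> by less than
      \<open>M\<close>; the summand \<open>M\<close> thus keeps them beyond \<open>T1\<close> and
      \<open>T2\<close>.\<close>
    fix x assume x: "max T1 T2 + M \<le> x"
    have large: "T1 \<le> \<theta>" "T2 \<le> \<theta>" if "\<theta> \<in> C x" for \<theta>
      using that bd[of \<theta>] x by (auto simp: C)
    have outer: "x - z - \<delta> < \<theta>" "\<theta> < x + z + \<delta>" if "\<theta> \<in> C x" for \<theta>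
      using that T1[OF large(1)[OF that]] by (auto simp: C)
    have inner: "\<theta> \<in> C x" if "x - z + \<delta> \<le> \<theta>" "\<theta> \<le> x + z - \<delta>" for \<theta>
    proof -
      have "T1 + M \<le> x" using x by simp
      then have "T1 \<le> \<theta>" using that z_less_M \<delta> by linarith
      from T1[OF this] that show ?thesis unfolding C by linarith
    qed
    have "is_interval (C x)"
      unfolding is_interval_1
    proof (intro ballI allI impI)
      fix p q \<theta> assume "p \<in> C x" "q \<in> C x" and *: "p \<le> \<theta> \<and> \<theta> \<le> q"
      \<comment> \<open>By monotonicity of the shifted endpoints, \<open>p\<close> supplies
        \<open>x < \<theta> + u \<theta>\<close> and \<open>q\<close> supplies
        \<open>\<theta> + l \<theta> < x\<close>.\<close>
      then have "p = \<theta> \<or> \<theta> = q \<or> \<theta> \<in> C x"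
        using T2[of p \<theta>] T2[of \<theta> q] large[of p] by (auto simp: C)
      then show "\<theta> \<in> C x" using \<open>p \<in> C x\<close> \<open>q \<in> C x\<close> by auto
    qed
    moreover have ne: "x \<in> C x" using inner[of x] \<delta> by auto
    moreover have bb: "bdd_below (C x)" "bdd_above (C x)"
      using outer by (meson bdd_belowI bdd_aboveI less_imp_le)+
    have "bounded (C x)"
      by (rule bounded_subset[OF bounded_closed_interval[of "x - z - \<delta>" "x + z + \<delta>"]])
        (meson atLeastAtMost_iff less_imp_le outer subsetI)
    moreover have "\<bar>Inf (C x) - (x - z)\<bar> \<le> \<epsilon>"
    proof -
      have "Inf (C x) \<le> x - z + \<delta>" using inner \<delta> by (intro cInf_lower bb) auto
      moreover have "x - z - \<delta> \<le> Inf (C x)" using ne outer by (intro cInf_greatest less_imp_le) auto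
      ultimately show ?thesis using \<delta> by linarith
    qed
    moreover have "\<bar>Sup (C x) - (x + z)\<bar> \<le> \<epsilon>"
    proof -
      have "x + z - \<delta> \<le> Sup (C x)" using inner \<delta> by (intro cSup_upper bb) auto
      moreover have "Sup (C x) \<le> x + z + \<delta>" using ne outer by (intro cSup_least less_imp_le) auto
      ultimately show ?thesis using \<delta> by linarith
    qed
    ultimately show "is_interval (C x) \<and> C x \<noteq> {} \<and> bounded (C x) \<and>
      \<bar>Inf (C x) - (x - z)\<bar> \<le> \<epsilon> \<and> \<bar>Sup (C x) - (x + z)\<bar> \<le> \<epsilon>" by blast
  qed
qed

lemma confidence_set_at_infinity:
  fixes w \<alpha> :: real
  assumes "0 < \<alpha>" "\<alpha> < 1" "0 < w" "0 < \<epsilon>"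
  defines "z \<equiv> z_quantile (\<alpha> / 2)" and "C \<equiv> confidence_set w \<alpha>"
  shows "\<forall>\<^sub>F x in at_infinity. is_interval (C x) \<and> C x \<noteq> {} \<and> bounded (C x) \<and>
    \<bar>Inf (C x) - (x - z)\<bar> \<le> \<epsilon> \<and> \<bar>Sup (C x) - (x + z)\<bar> \<le> \<epsilon>"
  unfolding at_infinity_eq_at_top_bot eventually_sup at_bot_mirror eventually_filtermap
proof (intro conjI)
  note top = confidence_set_at_top[OF assms(1-4), folded z_def C_def]
  show "\<forall>\<^sub>F x in at_top. is_interval (C x) \<and> C x \<noteq> {} \<and> bounded (C x) \<and>
    \<bar>Inf (C x) - (x - z)\<bar> \<le> \<epsilon> \<and> \<bar>Sup (C x) - (x + z)\<bar> \<le> \<epsilon>" by (fact top)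
  show "\<forall>\<^sub>F x in at_top. is_interval (C (- x)) \<and> C (- x) \<noteq> {} \<and> bounded (C (- x)) \<and>
    \<bar>Inf (C (- x)) - (- x - z)\<bar> \<le> \<epsilon> \<and> \<bar>Sup (C (- x)) - (- x + z)\<bar> \<le> \<epsilon>"
    using top
  proof eventually_elim
    case (elim x)
    have "C (- x) = uminus ` C x" by (simp add: C_def confidence_set_uminus)
    \<comment> \<open>Reflection exchanges the lower and upper endpoints, hence also their two
      estimates.\<close>
    moreover have "Inf (uminus ` C x) = - Sup (C x)" "Sup (uminus ` C x) = - Inf (C x)"
      by (simp_all add: Inf_real_def image_image)
    ultimately show ?case
      using elim by (auto simp: abs_le_iff bounded_uminus)
  qed
qed

theorem theorem2p3:
  fixes \<alpha> w :: real
  assumes "0 < \<alpha>" and "\<alpha> < 1" and "w > 0"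
  shows "(\<forall>\<^sub>F x in at_infinity. is_interval (confidence_set w \<alpha> x)
            \<and> confidence_set w \<alpha> x \<noteq> {} \<and> bounded (confidence_set w \<alpha> x))
       \<and> ((\<lambda>x. Inf (confidence_set w \<alpha> x) - (x - z_quantile (\<alpha> / 2))) \<longlongrightarrow> 0) at_infinity
       \<and> ((\<lambda>x. Sup (confidence_set w \<alpha> x) - (x + z_quantile (\<alpha> / 2))) \<longlongrightarrow> 0) at_infinity"
proof (intro conjI)
  note main = confidence_set_at_infinity[OF assms]
  show "\<forall>\<^sub>F x in at_infinity. is_interval (confidence_set w \<alpha> x)
            \<and> confidence_set w \<alpha> x \<noteq> {} \<and> bounded (confidence_set w \<alpha> x)"
    by (rule eventually_mono[OF main[of 1]]) auto
  show "((\<lambda>x. Inf (confidence_set w \<alpha> x) - (x - z_quantile (\<alpha> / 2))) \<longlongrightarrow> 0) at_infinity"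
  proof (rule tendstoI)
    fix e :: real assume "0 < e"
    then show "\<forall>\<^sub>F x in at_infinity. dist (Inf (confidence_set w \<alpha> x) - (x - z_quantile (\<alpha> / 2))) 0 < e"
      by (intro eventually_mono[OF main[of "e / 2"]]) (auto simp: dist_real_def)
  qed
  show "((\<lambda>x. Sup (confidence_set w \<alpha> x) - (x + z_quantile (\<alpha> / 2))) \<longlongrightarrow> 0) at_infinity"
  proof (rule tendstoI)
    fix e :: real assume "0 < e"
    then show "\<forall>\<^sub>F x in at_infinity. dist (Sup (confidence_set w \<alpha> x) - (x + z_quantile (\<alpha> / 2))) 0 < e"
      by (intro eventually_mono[OF main[of "e / 2"]]) (auto simp: dist_real_def)
  qed
qed

end
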